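(* Let $\mathbf{r}_0,\mathbf{r}_1,\ldots,\mathbf{r}_{N-1}$ be points in $D$-dimensional Euclidean space $\mathbb{R}^D$ and let $\mathrm{conv}_{\mathbf{r}}$ denote their convex hull. Then: (i) the points of every open shape of the $\kappa$-family of open shapes over these landmarks, $$\mathbf{r}_{\kappa}(t)=\sum_{j=0}^{N-1}\mathbf{r}_{j}\,\frac{\mathcal{B}_{\kappa}\left(t-j,\frac{1}{2}\right)}{\mathcal{B}_{\kappa}\left(t-\frac{N-1}{2},\frac{N}{2}\right)},$$ satisfy $\mathbf{r}_{\kappa}(t)\in \mathrm{conv}_{\mathbf{r}}$ for all $\kappa\in(0,\infty)$ and all real $t\in[0,N-1]$; (ii) the points of every closed shape of the $\kappa$-family of closed shapes over these landmarks, $$\mathbf{r}_{\kappa}(t)=\frac{\sum_{j=0}^{N-1}\mathbf{r}_{j}\,\Pi_{\kappa}\left(t-j,\frac{1}{2};N\right)}{\sum_{j=0}^{N-1}\Pi_{\kappa}\left(t-j,\frac{1}{2};N\right)},$$ satisfy $\mathbf{r}_{\kappa}(t)\in \mathrm{conv}_{\mathbf{r}}$ for all $\kappa\in(0,\infty)$ and all real $t\in[0,\infty)$.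
   Context: For $\kappa\in(0,\infty)$ and $x,y\in\mathbb{R}$, the $\mathcal{B}_\kappa$-function is $$\mathcal{B}_{\kappa}(x,y):=\frac{1}{2}\left[\tanh\left(\frac{x+y}{\kappa}\right)-\tanh\left(\frac{x-y}{\kappa}\right)\right],$$ and, for a real number $T>0$, the periodic $\mathcal{B}_\kappa$-function is $$\Pi_{\kappa}(x,y;T):=\mathcal{B}_{\kappa}\left(\sin\frac{\pi x}{T},\,\sin\frac{\pi y}{T}\right).$$ Here $N\ge 1$ and $D\ge 1$ are integers. The points $\mathbf{r}_0,\ldots,\mathbf{r}_{N-1}$ are called landmarks; they form a finite ordered sequence and repetitions are allowed. The first formula in the claim defines the $\kappa$-family of open (type-1) shapes over the landmarks and the second defines the $\kappa$-family of closed (type-2) shapes; each specific value of $\kappa\in(0,\infty)$ gives one shape of the family. *)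

theory Defs
  imports "HOL-Analysis.Analysis"
begin

definition B_fun :: "real \<Rightarrow> real \<Rightarrow> real \<Rightarrow> real" where
  "B_fun \<kappa> x y = 1 / 2 * (tanh ((x + y) / \<kappa>) - tanh ((x - y) / \<kappa>))"

definition periodic_B_fun :: "real \<Rightarrow> real \<Rightarrow> real \<Rightarrow> real \<Rightarrow> real" where
  "periodic_B_fun \<kappa> x y T = B_fun \<kappa> (sin (pi * x / T)) (sin (pi * y / T))"

text \<open>The landmarks are the values \<open>r 0, \<dots>, r (N - 1)\<close>; values of \<open>r\<close> at larger
  indices are never used.\<close>

definition open_shape :: "nat \<Rightarrow> (nat \<Rightarrow> real ^ 'd) \<Rightarrow> real \<Rightarrow> real \<Rightarrow> real ^ 'd" where
  "open_shape N r \<kappa> t =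
     (\<Sum>j<N. (B_fun \<kappa> (t - real j) (1 / 2)
               / B_fun \<kappa> (t - (real N - 1) / 2) (real N / 2)) *\<^sub>R r j)"

definition closed_shape :: "nat \<Rightarrow> (nat \<Rightarrow> real ^ 'd) \<Rightarrow> real \<Rightarrow> real \<Rightarrow> real ^ 'd" where
  "closed_shape N r \<kappa> t =
     (\<Sum>j<N. periodic_B_fun \<kappa> (t - real j) (1 / 2) (real N) *\<^sub>R r j)
       /\<^sub>R (\<Sum>j<N. periodic_B_fun \<kappa> (t - real j) (1 / 2) (real N))"

end

theory Submission
  imports Defs
begin

text \<open>Both shapes are convex combinations of the landmarks: their coefficients are positive
  and sum to 1. Positivity comes from strict monotonicity of \<open>tanh\<close>, giving
  \<open>B_fun_pos\<close> and, through the positive sine of pi/(2N),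
  \<open>periodic_B_fun_pos\<close>. The closed shape is divided by its total weight by definition;
  for the open shape, \<open>sum_B_fun_telescope\<close> identifies the denominator as the total
  weight. \<open>weighted_mean_in_convex_hull\<close> then settles both cases.\<close>

lemma B_fun_pos:
  assumes "\<kappa> > 0" and "y > 0"
  shows "B_fun \<kappa> x y > 0"
  using assms by (simp add: B_fun_def divide_strict_right_mono)

text \<open>Windows of half-width 1/2 around consecutive integers share endpoints, so the inner
  \<open>tanh\<close> terms cancel. The two that survive, at t + 1/2 and t - N + 1/2, are those of
  one window of half-width N/2 centred at (N - 1)/2.\<close>

lemma sum_B_fun_telescope:
  "(\<Sum>j<N. B_fun \<kappa> (t - real j) (1 / 2)) = B_fun \<kappa> (t - (real N - 1) / 2) (real N / 2)"
proof -
  define f where "f j = tanh ((t - real j + 1 / 2) / \<kappa>)" for j :: nat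
  have "t - (real N - 1) / 2 + real N / 2 = t + 1 / 2"
    and "t - (real N - 1) / 2 - real N / 2 = t - real N + 1 / 2"
    by (simp_all add: field_simps)
  then have rhs: "B_fun \<kappa> (t - (real N - 1) / 2) (real N / 2) = 1 / 2 * (f 0 - f N)"
    by (simp only: B_fun_def f_def of_nat_0 diff_zero)
  have "t - real j - 1 / 2 = t - real (Suc j) + 1 / 2" for j
    by simp
  then have "B_fun \<kappa> (t - real j) (1 / 2) = 1 / 2 * (f j - f (Suc j))" for j
    by (simp only: B_fun_def f_def)
  then have "(\<Sum>j<N. B_fun \<kappa> (t - real j) (1 / 2)) = 1 / 2 * (\<Sum>j<N. f j - f (Suc j))"
    by (simp only: sum_distrib_left)
  then show ?thesis
    by (simp only: rhs sum_lessThan_telescope')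
qed

lemma periodic_B_fun_pos:
  assumes "\<kappa> > 0" and "N \<ge> 1"
  shows "periodic_B_fun \<kappa> x (1 / 2) (real N) > 0"
proof -
  \<comment> \<open>The angle pi/(2N) lies strictly between 0 and pi, so its sine is a positive
    second argument for \<open>B_fun\<close>.\<close>
  have "pi * (1 / 2) / real N < pi"
    using assms(2) by (simp add: field_simps)
  then have "sin (pi * (1 / 2) / real N) > 0"
    using assms(2) by (intro sin_gt_zero) auto
  then show ?thesis
    using assms(1) by (simp add: periodic_B_fun_def B_fun_pos del: times_divide_eq_right)
qed

lemma weighted_mean_in_convex_hull:
  fixes r :: "'i \<Rightarrow> 'a::real_vector" and w :: "'i \<Rightarrow> real"
  assumes "finite I" and "I \<noteq> {}" and pos: "\<And>i. i \<in> I \<Longrightarrow> w i > 0"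
  shows "(\<Sum>i\<in>I. (w i / sum w I) *\<^sub>R r i) \<in> convex hull (r ` I)"
proof (rule convex_sum[OF \<open>finite I\<close> convex_convex_hull])
  \<comment> \<open>A nonempty sum of positive terms, so dividing by it is legitimate and preserves
    signs.\<close>
  have "sum w I > 0"
    using assms by (intro sum_pos) auto
  then show "(\<Sum>i\<in>I. w i / sum w I) = 1"
    by (simp add: sum_divide_distrib[symmetric])
  show "w i / sum w I \<ge> 0" if "i \<in> I" for i
    using pos[OF that] \<open>sum w I > 0\<close> by simp
  show "r i \<in> convex hull (r ` I)" if "i \<in> I" for i
    using that by (intro hull_inc) auto
qed

theorem mainTheorem1:
  fixes N :: nat and r :: "nat \<Rightarrow> real ^ 'd"
  assumes "N \<ge> 1"
  shows "(\<forall>\<kappa>>0. \<forall>t\<in>{0..real N - 1}. open_shape N r \<kappa> t \<in> convex hull (r ` {..<N})) \<and>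
         (\<forall>\<kappa>>0. \<forall>t\<ge>0. closed_shape N r \<kappa> t \<in> convex hull (r ` {..<N}))"
proof -
  have ne: "{..<N} \<noteq> {}"
    using assms by (auto simp: lessThan_empty_iff)
  have "open_shape N r \<kappa> t \<in> convex hull (r ` {..<N})" if "\<kappa> > 0" for \<kappa> t
    \<comment> \<open>Read from right to left, the telescoping identity turns each coefficient into
      a weight over the total weight.\<close>
    unfolding open_shape_def sum_B_fun_telescope[symmetric]
    using ne that by (intro weighted_mean_in_convex_hull) (auto intro: B_fun_pos)
  moreover have "closed_shape N r \<kappa> t \<in> convex hull (r ` {..<N})" if "\<kappa> > 0" for \<kappa> t
  proof -
    define w where "w j = periodic_B_fun \<kappa> (t - real j) (1 / 2) (real N)" for j
    \<comment> \<open>The single outer division is distributed over the terms to reach the form of a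
      weighted mean.\<close>
    have "closed_shape N r \<kappa> t = (\<Sum>j<N. (w j / sum w {..<N}) *\<^sub>R r j)"
      unfolding closed_shape_def w_def[symmetric]
      by (simp add: scaleR_sum_right divide_inverse mult.commute)
    also have "\<dots> \<in> convex hull (r ` {..<N})"
      using ne periodic_B_fun_pos[OF that assms]
      by (intro weighted_mean_in_convex_hull) (auto simp: w_def)
    finally show ?thesis .
  qed
  ultimately show ?thesis
    by blast
qed

end
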